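(* Let $k,\ell,t,q$ be positive integers with $k\geq 4$. There exists a constant $C$ depending on $k,\ell,t,q$ such that for every sufficiently large $n$ (depending on $k,\ell$), every family $\mathcal{F}\subseteq\binom{[n]}{k}$ with $|\mathcal{F}|\geq t\binom{n}{k-1}+Cn^{k-2+\frac{2}{k-1}}$ contains a copy of $\mathbb{P}^{(k)}_\ell$ or a copy of $[K_{t+1,q}]^{(k)}$.
   Context: A $k$-uniform linear path of length $\ell$, $\mathbb{P}^{(k)}_\ell$, is a family of $k$-sets $\{F_1,\ldots,F_\ell\}$ with $|F_i\cap F_{i+1}|=1$ for each $i$ and $F_i\cap F_j=\emptyset$ whenever $|i-j|>1$. For a graph $H$, the $k$-blowup $[H]^{(k)}$ is the $k$-uniform hypergraph obtained by replacing each edge $xy$ of $H$ by a $k$-set consisting of $x$, $y$ and $k-2$ new vertices, where the new vertex sets are pairwise disjoint for distinct edges. $K_{t+1,q}$ is the complete bipartite graph with parts of sizes $t+1$ and $q$. A family contains a copy of a hypergraph if some subfamily is isomorphic to it. *)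

theory Defs
  imports Complex_Main "HOL-Library.Ramsey"
begin

text \<open>
  Hypergraphs are represented by their edge families, with vertex set the union of the edges.
  Nothing is lost here, since neither linear paths nor blowups of complete bipartite graphs with
  nonempty parts have isolated vertices.  The family of all \<open>k\<close>-subsets of \<open>A\<close> is
  \<^term>\<open>nsets A k\<close>.
\<close>

definition hypergraph_iso :: "'a set set \<Rightarrow> 'b set set \<Rightarrow> bool" where
  "hypergraph_iso G H \<longleftrightarrow> (\<exists>f. bij_betw f (\<Union>G) (\<Union>H) \<and> H = (\<lambda>e. f ` e) ` G)"

definition contains_copy :: "'a set set \<Rightarrow> 'b set set \<Rightarrow> bool" where
  "contains_copy F H \<longleftrightarrow> (\<exists>F'\<subseteq>F. hypergraph_iso H F')"

text \<open>
  The edges \<open>E 0, \<dots>, E (l - 1)\<close> are automatically distinct when \<open>k \<ge> 2\<close>, and then all linear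
  paths with the same \<open>k\<close> and \<open>l\<close> are isomorphic.
\<close>

definition linear_path :: "nat \<Rightarrow> nat \<Rightarrow> 'a set set \<Rightarrow> bool" where
  "linear_path k l P \<longleftrightarrow>
     (\<exists>E :: nat \<Rightarrow> 'a set.
        P = E ` {..<l} \<and>
        (\<forall>i<l. E i \<in> nsets UNIV k) \<and>
        (\<forall>i. i + 1 < l \<longrightarrow> card (E i \<inter> E (i + 1)) = 1) \<and>
        (\<forall>i j. i + 1 < j \<and> j < l \<longrightarrow> E i \<inter> E j = {}))"

text \<open>Since \<^term>\<open>linear_path\<close> describes the path up to isomorphism, a copy of it is a copy
  of any of its representatives; representatives on the natural numbers exist for all \<open>k \<ge> 2\<close>.\<close>

definition contains_linear_path :: "nat \<Rightarrow> nat \<Rightarrow> 'a set set \<Rightarrow> bool" where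
  "contains_linear_path k l F \<longleftrightarrow> (\<exists>P :: nat set set. linear_path k l P \<and> contains_copy F P)"

definition complete_bipartite :: "nat \<Rightarrow> nat \<Rightarrow> (nat + nat) set set" where
  "complete_bipartite a b = {{Inl i, Inr j} | i j. i < a \<and> j < b}"

text \<open>
  The graph \<open>H\<close> is given by its two-element edges, and \<open>k \<ge> 2\<close> is intended.  The new vertices
  of an edge \<open>e\<close> are the pairs \<open>(e, i)\<close> with \<open>i < k - 2\<close>; tagging them with \<open>e\<close> makes the sets
  of new vertices of distinct edges disjoint.
\<close>

definition blowup :: "nat \<Rightarrow> 'a set set \<Rightarrow> ('a + 'a set \<times> nat) set set" where
  "blowup k H = (\<lambda>e. Inl ` e \<union> Inr ` ({e} \<times> {..<k - 2})) ` H"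

end

theory Submission
  imports Defs "HOL-Library.FuncSet"
begin

text \<open>
  A set \<open>A\<close> is a kernel if the remainders \<open>e - A\<close> of the edges through it cannot be covered by few
  vertices, so that sparsely intersecting families of kernels expand greedily to edges of \<open>F\<close>.
  If no edge of a family has a vertex \<open>x\<close> for which all \<open>{x, y}\<close>, \<open>y\<close> in the edge, are kernels,
  then the family has only \<open>O(n^(k-2))\<close> edges: otherwise a homogeneous subfamily (Furedi) has the
  property that every \<open>(k-2)\<close>-set of colours lies in the colour set of a kernel, and as these colour
  sets are closed under intersection there are either two singletons, which yield a path, or
  a colour \<open>c\<close> with all pairs \<open>{c, j}\<close>.

  All other edges are a vertex together with \<open>k - 1\<close> of its neighbours in the graph of two-element
  kernels. This graph has no path of length \<open>l\<close>, hence is degenerate, and contains no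
  \<open>K_{t+1,q}\<close>; in such a graph the \<open>(k-1)\<close>-sets have at most \<open>t\<close> common neighbours each, up to an
  excess of \<open>O(n)\<close> in total. The resulting error term \<open>O(n^(k-2))\<close> is better than required.
\<close>

section \<open>Kernels and their greedy expansion to edges\<close>

text \<open>This weakens being the core of a sunflower with \<open>s\<close> petals, where fewer
  than \<open>s\<close> vertices always miss a petal. The form with \<open>X\<close> serves both
  uses: the property supplies an edge avoiding prescribed vertices, and its failure supplies a small
  set meeting all remainders.\<close>

definition delta_kernel :: "nat \<Rightarrow> 'a set set \<Rightarrow> 'a set \<Rightarrow> bool" where
  "delta_kernel s F A \<longleftrightarrow> (\<forall>X. finite X \<and> card X < s \<longrightarrow> (\<exists>e\<in>F. A \<subseteq> e \<and> (e - A) \<inter> X = {}))"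

lemma kernelD:
  assumes "delta_kernel s F A" "finite X" "card X < s"
  obtains e where "e \<in> F" "A \<subseteq> e" "(e - A) \<inter> X = {}"
  using assms unfolding delta_kernel_def by blast

lemma kernel_mono: "delta_kernel s F A \<Longrightarrow> F \<subseteq> G \<Longrightarrow> delta_kernel s G A"
  unfolding delta_kernel_def by (meson subsetD)

lemma card_kernel_le:
  assumes "delta_kernel s F A" "0 < s" "F \<subseteq> nsets UNIV k"
  shows "finite A" "card A \<le> k"
proof -
  obtain e where "e \<in> F" "A \<subseteq> e"
    using assms(1,2) by (auto elim: kernelD[where X = "{}"])
  then show "finite A" "card A \<le> k"
    using assms(3) by (auto simp: nsets_def intro: finite_subset card_mono)
qed

lemma card_UN_le_mult:
  assumes "finite I" "\<And>i. i \<in> I \<Longrightarrow> card (A i) \<le> k"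
  shows "card (\<Union>i\<in>I. A i) \<le> k * card I"
proof -
  have "card (\<Union>i\<in>I. A i) \<le> (\<Sum>i\<in>I. card (A i))"
    using assms(1) by (rule card_UN_le)
  also have "\<dots> \<le> card I * k"
    using assms(2) sum_bounded_above[of I "\<lambda>i. card (A i)" k] by auto
  finally show ?thesis by (simp add: mult.commute)
qed

text \<open>Greedy choice: outside its own kernel, a new edge avoids all kernels and all edges
  chosen before. These cover at most \<open>2 * k * card I\<close> vertices, which is less than
  \<open>s\<close>. So no intersections arise beyond those of the kernels.\<close>

lemma expand_kernels:
  assumes "finite I" and F: "F \<subseteq> nsets UNIV k"
    and ker: "\<And>i. i \<in> I \<Longrightarrow> delta_kernel s F (K i)"
    and s: "2 * k * card I < s"
  shows "\<exists>E. (\<forall>i\<in>I. E i \<in> F \<and> K i \<subseteq> E i) \<and>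
    (\<forall>i\<in>I. \<forall>j\<in>I. i \<noteq> j \<longrightarrow> E i \<inter> E j = K i \<inter> K j)"
proof -
  have K: "finite (K i)" "card (K i) \<le> k" if "i \<in> I" for i
    using card_kernel_le[OF ker[OF that] _ F] s by auto
  have fF: "finite e" "card e = k" if "e \<in> F" for e
    using that F by (auto simp: nsets_def)
  \<comment> \<open>The chosen edges must avoid the kernels of the whole of \<open>I\<close>,
    including those not yet expanded; otherwise a later kernel could already meet an earlier
    edge.\<close>
  have "\<exists>E. \<forall>i\<in>J. E i \<in> F \<and> K i \<subseteq> E i \<and> (E i - K i) \<inter> (\<Union>j\<in>I. K j) = {} \<and>
         (\<forall>j\<in>J. i \<noteq> j \<longrightarrow> E i \<inter> E j = K i \<inter> K j)" if "finite J" "J \<subseteq> I" for J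
    using that
  proof (induction J)
    case empty
    then show ?case by simp
  next
    case (insert i J)
    then obtain E where E: "\<forall>i\<in>J. E i \<in> F \<and> K i \<subseteq> E i \<and> (E i - K i) \<inter> (\<Union>j\<in>I. K j) = {} \<and>
         (\<forall>j\<in>J. i \<noteq> j \<longrightarrow> E i \<inter> E j = K i \<inter> K j)" by auto
    let ?X = "(\<Union>j\<in>I. K j) \<union> (\<Union>j\<in>J. E j)"
    have "card ?X \<le> card (\<Union>j\<in>I. K j) + card (\<Union>j\<in>J. E j)"
      by (rule card_Un_le)
    also have "\<dots> \<le> k * card I + k * card J"
      using K E fF insert by (intro add_mono card_UN_le_mult \<open>finite I\<close>) auto
    also have "\<dots> \<le> 2 * k * card I"
      using insert card_mono[OF \<open>finite I\<close>, of J] by auto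
    also have "\<dots> < s" by fact
    finally have "card ?X < s" .
    moreover have "finite ?X"
      using K E fF insert \<open>finite I\<close> by auto
    moreover have "delta_kernel s F (K i)"
      using ker insert by auto
    ultimately obtain e where e: "e \<in> F" "K i \<subseteq> e" "(e - K i) \<inter> ?X = {}"
      by (metis kernelD)
    have i: "i \<in> I" "i \<notin> J" "J \<subseteq> I" using insert by auto
    have new: "e \<inter> E j = K i \<inter> K j" if "j \<in> J" for j
    proof
      show "e \<inter> E j \<subseteq> K i \<inter> K j"
      proof
        fix x assume x: "x \<in> e \<inter> E j"
        then have "x \<in> ?X" using that by blast
        then have "x \<in> K i" using e(3) x by blast
        moreover from this have "x \<in> (\<Union>j\<in>I. K j)" using i by blast
        then have "x \<in> K j" using E that x by blast
        ultimately show "x \<in> K i \<inter> K j" ..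
      qed
      have "K j \<subseteq> E j" using E that by simp
      then show "K i \<inter> K j \<subseteq> e \<inter> E j" using e(2) by blast
    qed
    have disj: "(e - K i) \<inter> (\<Union>j\<in>I. K j) = {}" using e(3) by blast
    show ?case
    proof (rule exI[of _ "E(i := e)"], intro ballI conjI impI)
      fix j j' assume "j \<in> insert i J" "j' \<in> insert i J" "j \<noteq> j'"
      then consider "j = i" "j' \<in> J" "j' \<noteq> i" | "j \<in> J" "j' = i" "j \<noteq> i" 
        | "j \<in> J" "j' \<in> J" "j \<noteq> j'" "j \<noteq> i" "j' \<noteq> i"
        using i by blast
      then show "(E(i := e)) j \<inter> (E(i := e)) j' = K j \<inter> K j'"
      proof cases
        case 2
        then show ?thesis using new[of j] by (simp add: Int_commute)
      qed (use E new in auto)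
    qed (use E e(1,2) disj i in auto)
  qed
  from this[OF \<open>finite I\<close> subset_refl] obtain E where
    "\<forall>i\<in>I. E i \<in> F \<and> K i \<subseteq> E i \<and> (E i - K i) \<inter> (\<Union>j\<in>I. K j) = {} \<and>
         (\<forall>j\<in>I. i \<noteq> j \<longrightarrow> E i \<inter> E j = K i \<inter> K j)" ..
  then show ?thesis by (intro exI[of _ E]) blast
qed

section \<open>Linear paths from kernels\<close>

lemma linear_pathI:
  assumes "\<And>i. i < l \<Longrightarrow> E i \<in> nsets UNIV k"
    and "\<And>i. i + 1 < l \<Longrightarrow> card (E i \<inter> E (i + 1)) = 1"
    and "\<And>i j. i + 1 < j \<Longrightarrow> j < l \<Longrightarrow> E i \<inter> E j = {}"
  shows "linear_path k l (E ` {..<l})"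
  unfolding linear_path_def
  by (rule exI[of _ E], intro conjI refl allI impI) (use assms in blast)+

text \<open>Expansion preserves intersections, so the edges grown from a graph path meet just as the
  pairs do: consecutive ones in a single vertex, others not at all.\<close>

lemma linear_path_of_kernel_path:
  assumes F: "F \<subseteq> nsets UNIV k" and v: "inj_on v {..l}"
    and ker: "\<And>i. i < l \<Longrightarrow> delta_kernel s F {v i, v (Suc i)}" and s: "2 * k * l < s"
  shows "\<exists>P\<subseteq>F. linear_path k l P"
proof -
  obtain E where E: "\<And>i. i < l \<Longrightarrow> E i \<in> F"
      "\<And>i j. i < l \<Longrightarrow> j < l \<Longrightarrow> i \<noteq> j \<Longrightarrow> E i \<inter> E j = {v i, v (Suc i)} \<inter> {v j, v (Suc j)}"
  proof -
    have "2 * k * card {..<l} < s" using s by simp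
    from expand_kernels[of "{..<l}" F k s "\<lambda>i. {v i, v (Suc i)}", OF _ F _ this] ker
    show thesis using that by (metis finite_lessThan lessThan_iff)
  qed
  have veq: "v i = v j \<longleftrightarrow> i = j" if "i \<le> l" "j \<le> l" for i j
    using v that by (auto simp: inj_on_def)
  have "linear_path k l (E ` {..<l})"
  proof (rule linear_pathI)
    show "E i \<in> nsets UNIV k" if "i < l" for i
      using E(1)[OF that] F by blast
    show "card (E i \<inter> E (i + 1)) = 1" if "i + 1 < l" for i
    proof -
      have "E i \<inter> E (i + 1) = {v (Suc i)}"
        using that by (subst E(2)) (auto simp: veq)
      then show ?thesis by simp
    qed
    show "E i \<inter> E j = {}" if "i + 1 < j" "j < l" for i j
      using that by (subst E(2)) (auto simp: veq)
  qed
  moreover have "E ` {..<l} \<subseteq> F" using E(1) by auto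
  ultimately show ?thesis by blast
qed

text \<open>The path is prolonged at a singleton kernel \<open>p\<close> of its last edge: some edge
  through \<open>p\<close> avoids all other vertices used so far. As it contains two singleton
  kernels, one of them differs from \<open>p\<close> and is the new end.\<close>

lemma linear_path_of_singleton_kernels:
  assumes F: "F \<subseteq> nsets UNIV k" "F \<noteq> {}"
    and two: "\<And>e. e \<in> F \<Longrightarrow> \<exists>x\<in>e. \<exists>y\<in>e. x \<noteq> y \<and> delta_kernel s F {x} \<and> delta_kernel s F {y}"
    and s: "k * l < s"
  shows "\<exists>P\<subseteq>F. linear_path k l P"
proof -
  have fF: "finite e" "card e = k" if "e \<in> F" for e
    using that F by (auto simp: nsets_def)
  \<comment> \<open>The end \<open>p\<close> must lie on no earlier edge, since the next edge
    contains it.\<close>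
  have "\<exists>E p. (\<forall>i\<le>m. E i \<in> F) \<and> (\<forall>i<m. card (E i \<inter> E (Suc i)) = 1) \<and>
     (\<forall>i j. Suc i < j \<and> j \<le> m \<longrightarrow> E i \<inter> E j = {}) \<and>
     p \<in> E m \<and> delta_kernel s F {p} \<and> (\<forall>i<m. p \<notin> E i)" if "m < l" for m
    using that
  proof (induction m)
    case 0
    obtain e where "e \<in> F" using F by blast
    moreover from two[OF this] obtain p where "p \<in> e" "delta_kernel s F {p}" by blast
    ultimately show ?case by (intro exI[of _ "\<lambda>_. e"] exI[of _ p]) auto
  next
    case (Suc m)
    then obtain E p where E: "\<And>i. i \<le> m \<Longrightarrow> E i \<in> F" "\<And>i. i < m \<Longrightarrow> card (E i \<inter> E (Suc i)) = 1"
      "\<And>i j. Suc i < j \<Longrightarrow> j \<le> m \<Longrightarrow> E i \<inter> E j = {}"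
      and p: "p \<in> E m" "delta_kernel s F {p}" "\<And>i. i < m \<Longrightarrow> p \<notin> E i"
      by (metis Suc_lessD)
    let ?X = "\<Union>i\<in>{..m}. E i"
    have "card ?X \<le> k * card {..m}"
      using E fF by (intro card_UN_le_mult) auto
    also have "\<dots> \<le> k * l" using Suc.prems by (intro mult_left_mono) auto
    also have "\<dots> < s" by fact
    finally have "card ?X < s" .
    moreover have "finite ?X" using E fF by auto
    ultimately obtain e where e: "e \<in> F" "{p} \<subseteq> e" "(e - {p}) \<inter> ?X = {}"
      using p(2) by (metis kernelD)
    obtain p' where p': "p' \<in> e" "p' \<noteq> p" "delta_kernel s F {p'}"
      using two[OF e(1)] by metis
    have disj: "E i \<inter> e = {}" if "i < m" for i
      using e(3) p(3)[OF that] that by fastforce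
    have meet: "E m \<inter> e = {p}"
      using e p(1) by fastforce
    have p'E: "p' \<notin> E i" if "i \<le> m" for i
      using e(3) p' that by blast
    show ?case
    proof (intro exI[of _ "E(Suc m := e)"] exI[of _ p'] conjI allI impI)
      fix i assume "i < Suc m"
      then show "card ((E(Suc m := e)) i \<inter> (E(Suc m := e)) (Suc i)) = 1"
        using E(2)[of i] meet by (cases "i = m") auto
    next
      fix i j assume "Suc i < j \<and> j \<le> Suc m"
      then show "(E(Suc m := e)) i \<inter> (E(Suc m := e)) j = {}"
        using E(3)[of i j] disj[of i] by (cases "j = Suc m") auto
    qed (use E e p' p'E in \<open>auto simp: le_Suc_eq\<close>)
  qed
  note path = this
  show ?thesis
  proof (cases "l = 0")
    case True
    then show ?thesis by (intro exI[of _ "{}"]) (auto simp: linear_path_def)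
  next
    case False
    obtain E where E: "\<And>i. i \<le> l - 1 \<Longrightarrow> E i \<in> F" 
      "\<And>i. i < l - 1 \<Longrightarrow> card (E i \<inter> E (Suc i)) = 1"
      "\<And>i j. Suc i < j \<Longrightarrow> j \<le> l - 1 \<Longrightarrow> E i \<inter> E j = {}"
      using path[of "l - 1"] False by (metis diff_less less_one neq0_conv)
    have "linear_path k l (E ` {..<l})"
    proof (rule linear_pathI)
      show "E i \<in> nsets UNIV k" if "i < l" for i
        using E(1)[of i] that F(1) by auto
      show "card (E i \<inter> E (i + 1)) = 1" if "i + 1 < l" for i
        using E(2)[of i] that by simp
      show "E i \<inter> E j = {}" if "i + 1 < j" "j < l" for i j
        using E(3)[of i j] that by simp
    qed
    moreover have "E ` {..<l} \<subseteq> F" using E(1) by auto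
    ultimately show ?thesis by blast
  qed
qed

section \<open>Blowups from kernels\<close>

text \<open>Outside the image of \<open>\<phi>\<close> each \<open>E h\<close> has exactly
  \<open>k - 2\<close> points, and by \<open>int\<close> no other edge contains them. These private
  points are matched with the new vertices of \<open>h\<close>.\<close>

lemma hypergraph_iso_blowup:
  assumes H: "\<And>h. h \<in> H \<Longrightarrow> card h = 2"
    and \<phi>: "inj_on \<phi> (\<Union>H)"
    and E: "\<And>h. h \<in> H \<Longrightarrow> E h \<in> nsets UNIV k" "\<And>h. h \<in> H \<Longrightarrow> \<phi> ` h \<subseteq> E h"
    and int: "\<And>h h'. h \<in> H \<Longrightarrow> h' \<in> H \<Longrightarrow> h \<noteq> h' \<Longrightarrow> E h \<inter> E h' = \<phi> ` h \<inter> \<phi> ` h'"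
  shows "hypergraph_iso (blowup k H) (E ` H)"
proof -
  have "\<exists>g. bij_betw g {..<k - 2} (E h - \<phi> ` h)" if "h \<in> H" for h
  proof -
    have "card (\<phi> ` h) = 2"
      using H[OF that] \<phi> that by (metis Union_upper card_image inj_on_subset)
    then have "card (E h - \<phi> ` h) = k - 2"
      using E[OF that] by (subst card_Diff_subset) (auto simp: nsets_def intro: finite_subset)
    moreover have "finite (E h - \<phi> ` h)" using E[OF that] by (auto simp: nsets_def)
    ultimately show ?thesis
      by (metis atLeast0LessThan ex_bij_betw_nat_finite)
  qed
  then obtain g where g: "\<And>h. h \<in> H \<Longrightarrow> bij_betw (g h) {..<k - 2} (E h - \<phi> ` h)" by metis
  define f where "f = case_sum \<phi> (\<lambda>(h, i). g h i)"
  have img: "f ` (Inl ` h \<union> Inr ` ({h} \<times> {..<k - 2})) = E h" if "h \<in> H" for h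
  proof -
    have "f ` (Inl ` h \<union> Inr ` ({h} \<times> {..<k - 2})) = \<phi> ` h \<union> g h ` {..<k - 2}"
      by (force simp: f_def image_Un image_image)
    then show ?thesis using g[OF that] E(2)[OF that] by (auto simp: bij_betw_def)
  qed
  have gin: "g h i \<in> E h" "g h i \<notin> \<phi> ` h" if "h \<in> H" "i < k - 2" for h i
    using g[OF that(1)] that(2) by (auto simp: bij_betw_def)
  have gphi: "g h i \<noteq> \<phi> x" if "h \<in> H" "i < k - 2" "h' \<in> H" "x \<in> h'" for h i h' x
    using gin[OF that(1,2)] int[OF that(1,3)] E(2)[OF that(3)] that(4) by (metis IntI Int_iff image_eqI subsetD)
  have ginj: "h = h' \<and> i = j" if "h \<in> H" "i < k - 2" "h' \<in> H" "j < k - 2" "g h i = g h' j" for h i h' j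
  proof -
    have "h = h'"
      using gin[OF that(1,2)] int[OF that(1,3)] gin[OF that(3,4)] that(5) by (metis IntI Int_iff)
    then show ?thesis
      using g[OF that(1)] that by (auto simp: bij_betw_def inj_on_def)
  qed
  have "inj_on f (\<Union>(blowup k H))"
  proof (rule inj_onI)
    fix u v assume uv: "u \<in> \<Union>(blowup k H)" "v \<in> \<Union>(blowup k H)" "f u = f v"
    have "(\<exists>x\<in>\<Union>H. w = Inl x) \<or> (\<exists>h\<in>H. \<exists>i<k - 2. w = Inr (h, i))"
      if "w \<in> \<Union>(blowup k H)" for w
      using that by (auto simp: blowup_def)
    from this[OF uv(1)] this[OF uv(2)]
    consider x y where "x \<in> \<Union>H" "y \<in> \<Union>H" "u = Inl x" "v = Inl y"
      | x h i where "x \<in> \<Union>H" "h \<in> H" "i < k - 2" "u = Inl x" "v = Inr (h, i)"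
      | x h i where "x \<in> \<Union>H" "h \<in> H" "i < k - 2" "v = Inl x" "u = Inr (h, i)"
      | h i h' j where "h \<in> H" "i < k - 2" "h' \<in> H" "j < k - 2" "u = Inr (h, i)" "v = Inr (h', j)"
      by blast
    then show "u = v"
    proof cases
      case 1
      then show ?thesis using uv(3) \<phi> by (auto simp: f_def inj_on_def)
    next
      case 2
      then show ?thesis using uv(3) gphi[of h i] by (fastforce simp: f_def)
    next
      case 3
      then show ?thesis using uv(3) gphi[of h i] by (fastforce simp: f_def)
    next
      case 4
      then show ?thesis using uv(3) ginj[of h i h' j] by (simp add: f_def)
    qed
  qed
  moreover have "(\<lambda>e. f ` e) ` blowup k H = E ` H"
    unfolding blowup_def image_image using img by (rule image_cong[OF refl])
  moreover from this have "f ` \<Union>(blowup k H) = \<Union>(E ` H)"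
    by (metis image_Union)
  ultimately show ?thesis
    unfolding hypergraph_iso_def by (auto simp: bij_betw_def intro!: exI[of _ f])
qed

lemma complete_bipartite_conv_image:
  "complete_bipartite a b = (\<lambda>(i, j). {Inl i, Inr j}) ` ({..<a} \<times> {..<b})"
  by (auto simp: complete_bipartite_def)

text \<open>The pairs between \<open>A\<close> and \<open>B\<close> form a complete bipartite graph
  of kernels; expanding its at most \<open>a * b\<close> edges simultaneously gives the
  blowup.\<close>

lemma blowup_of_kernels:
  assumes F: "F \<subseteq> nsets UNIV k" and A: "card A = a" "finite A" and B: "card B = b" "finite B"
    and AB: "A \<inter> B = {}" and ker: "\<And>x y. x \<in> A \<Longrightarrow> y \<in> B \<Longrightarrow> delta_kernel s F {x, y}"
    and s: "2 * k * (a * b) < s"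
  shows "contains_copy F (blowup k (complete_bipartite a b))"
proof -
  let ?H = "complete_bipartite a b"
  obtain \<alpha> where \<alpha>: "bij_betw \<alpha> {..<a} A" 
    using A by (metis atLeast0LessThan ex_bij_betw_nat_finite)
  obtain \<beta> where \<beta>: "bij_betw \<beta> {..<b} B" 
    using B by (metis atLeast0LessThan ex_bij_betw_nat_finite)
  define \<phi> where "\<phi> = case_sum \<alpha> \<beta>"
  have inA: "\<alpha> i \<in> A" if "i < a" for i using \<alpha> that by (auto simp: bij_betw_def)
  have inB: "\<beta> i \<in> B" if "i < b" for i using \<beta> that by (auto simp: bij_betw_def)
  have "card ?H \<le> a * b"
    unfolding complete_bipartite_conv_image
    by (metis card_cartesian_product card_image_le card_lessThan finite_SigmaI finite_lessThan)
  then have cardH: "2 * k * card ?H < s"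
    using s by (metis le_less_trans mult_le_mono2)
  have finH: "finite ?H" unfolding complete_bipartite_conv_image by simp
  have kerH: "delta_kernel s F (\<phi> ` h)" if "h \<in> ?H" for h
    using that ker inA inB by (auto simp: complete_bipartite_def \<phi>_def)
  have "\<exists>E. (\<forall>h\<in>?H. E h \<in> F \<and> \<phi> ` h \<subseteq> E h) \<and>
    (\<forall>h\<in>?H. \<forall>h'\<in>?H. h \<noteq> h' \<longrightarrow> E h \<inter> E h' = \<phi> ` h \<inter> \<phi> ` h')"
    by (rule expand_kernels[OF finH F kerH cardH])
  then obtain E where E: "\<forall>h\<in>?H. E h \<in> F \<and> \<phi> ` h \<subseteq> E h"
    "\<forall>h\<in>?H. \<forall>h'\<in>?H. h \<noteq> h' \<longrightarrow> E h \<inter> E h' = \<phi> ` h \<inter> \<phi> ` h'"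
    by (elim exE conjE)
  have sub: "\<Union>?H \<subseteq> {..<a} <+> {..<b}"
    by (auto simp: complete_bipartite_def)
  have "inj_on \<phi> ({..<a} <+> {..<b})"
  proof (rule inj_onI)
    fix x y assume xy: "x \<in> {..<a} <+> {..<b}" "y \<in> {..<a} <+> {..<b}" "\<phi> x = \<phi> y"
    have "\<alpha> i \<noteq> \<beta> j" if "i < a" "j < b" for i j
      using inA[OF that(1)] inB[OF that(2)] AB by auto
    then show "x = y"
      using xy \<alpha> \<beta> by (cases x; cases y) (force simp: \<phi>_def bij_betw_def inj_on_def)+
  qed
  then have "inj_on \<phi> (\<Union>?H)" using sub by (rule inj_on_subset)
  then have "hypergraph_iso (blowup k ?H) (E ` ?H)"
  proof (rule hypergraph_iso_blowup[rotated])
    show "card h = 2" if "h \<in> ?H" for h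
      using that by (auto simp: complete_bipartite_def)
    show "E h \<in> nsets UNIV k" if "h \<in> ?H" for h
      using E(1) that F by blast
  qed (use E in \<open>simp_all\<close>)
  moreover have "E ` ?H \<subseteq> F" using E(1) by auto
  ultimately show ?thesis unfolding contains_copy_def by blast
qed

text \<open>As the vertices are natural numbers, a path inside \<open>F\<close> is its own
  representative, with the identity as isomorphism.\<close>

lemma contains_linear_pathI:
  fixes F :: "nat set set"
  assumes "P \<subseteq> F" "linear_path k l P"
  shows "contains_linear_path k l F"
proof -
  have "hypergraph_iso P P"
    unfolding hypergraph_iso_def by (intro exI[of _ id]) auto
  then show ?thesis
    using assms unfolding contains_linear_path_def contains_copy_def by blast
qed

section \<open>Degenerate graphs and common neighbourhoods\<close>

text \<open>If all degrees within \<open>W\<close> were at least \<open>l\<close>, a path could be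
  extended greedily inside \<open>W\<close> until it has \<open>l\<close> edges.\<close>

lemma low_degree_vertex_if_no_path:
  assumes W: "finite W" "W \<noteq> {}"
    and irrefl: "\<And>x. \<not> adj x x"
    and nopath: "\<not> (\<exists>v. inj_on v {..l} \<and> (\<forall>i<l. adj (v i) (v (Suc i))))"
  shows "\<exists>x\<in>W. card {y\<in>W. adj x y} < l"
proof (rule ccontr)
  assume "\<not> ?thesis"
  then have deg: "l \<le> card {y\<in>W. adj x y}" if "x \<in> W" for x
    using that by (auto simp: not_less)
  have "\<exists>v. inj_on v {..m} \<and> v m \<in> W \<and> (\<forall>i<m. adj (v i) (v (Suc i)))" if "m \<le> l" for m
    using that
  proof (induction m)
    case 0
    obtain x where "x \<in> W" using W by blast
    then show ?case by (intro exI[of _ "\<lambda>_. x"]) auto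
  next
    case (Suc m)
    then obtain v where v: "inj_on v {..m}" "v m \<in> W" "\<forall>i<m. adj (v i) (v (Suc i))" by auto
    \<comment> \<open>The end \<open>v m\<close> is not its own neighbour, so only the
      \<open>m\<close> vertices before it can block, and \<open>m\<close> is less than
      \<open>l\<close>.\<close>
    have "\<not> {y\<in>W. adj (v m) y} \<subseteq> v ` {..<m}"
    proof
      assume "{y\<in>W. adj (v m) y} \<subseteq> v ` {..<m}"
      then have "card {y\<in>W. adj (v m) y} \<le> card (v ` {..<m})"
        by (intro card_mono) auto
      also have "\<dots> \<le> m" using card_image_le[of "{..<m}" v] by simp
      finally show False using deg[OF v(2)] Suc.prems by simp
    qed
    then obtain y where y: "y \<in> W" "adj (v m) y" "y \<notin> v ` {..<m}" by auto
    then have "y \<noteq> v m" using irrefl by auto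
    then have "y \<notin> v ` {..m}" using y(3) by (auto simp: less_le)
    then have "inj_on (v(Suc m := y)) {..Suc m}"
      using v(1) by (auto simp: inj_on_def atMost_Suc)
    moreover have "\<forall>i<Suc m. adj ((v(Suc m := y)) i) ((v(Suc m := y)) (Suc i))"
      using v y by (auto simp: less_Suc_eq)
    ultimately show ?case
      using y(1) by (intro exI[of _ "v(Suc m := y)"]) (simp del: fun_upd_apply, simp)
  qed
  with nopath show False by blast
qed

text \<open>The error term counts, for each \<open>r\<close>-set, its common neighbours beyond the first \<open>t\<close>;
  deleting a vertex of small degree changes it by a bounded amount only.\<close>

lemma sum_excess_common_neighbours_le:
  fixes adj :: "'a \<Rightarrow> 'a \<Rightarrow> bool"
  assumes "finite V" and "0 < r"
    and sym: "\<And>x y. adj x y \<Longrightarrow> adj y x" and irrefl: "\<And>x. \<not> adj x x"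
    and degen: "\<And>W. W \<subseteq> V \<Longrightarrow> W \<noteq> {} \<Longrightarrow> \<exists>x\<in>W. card {y\<in>W. adj x y} < d"
    and free: "\<And>A. A \<subseteq> V \<Longrightarrow> card A = Suc t \<Longrightarrow> card {y\<in>V. \<forall>x\<in>A. adj x y} < q"
  shows "(\<Sum>S\<in>nsets V r. card {x\<in>V. \<forall>y\<in>S. adj x y} - t) \<le> (2 ^ d + d * (2 ^ d * 2 ^ q)) * card V"
  using assms(1) degen free
proof (induction "card V" arbitrary: V)
  case 0
  then show ?case using \<open>0 < r\<close> by (simp add: nsets_def)
next
  case (Suc n)
  note fV = Suc.prems(1) and free = Suc.prems(3)
  have "V \<noteq> {}" using Suc.hyps(2) by auto
  with Suc.prems(2)[of V] obtain v where v: "v \<in> V" "card {y\<in>V. adj v y} < d" by auto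
  define W where "W = V - {v}"
  define N where "N = {y\<in>V. adj v y}"
  define com where "com U S = {x\<in>U. \<forall>y\<in>S. adj x y}" for U S
  have N: "finite N" "card N \<le> d" "N \<subseteq> V" "v \<notin> N" using v fV irrefl by (auto simp: N_def)
  have V: "V = insert v W" "v \<notin> W" "finite W" "W \<subseteq> V" using v fV by (auto simp: W_def)
  have powN: "card (Pow N) \<le> 2 ^ d" using N by (simp add: card_Pow)
  have fcom: "finite (com U S)" if "finite U" for U S using that by (auto simp: com_def)
  have IH: "(\<Sum>S\<in>nsets W r. card (com W S) - t) \<le> (2 ^ d + d * (2 ^ d * 2 ^ q)) * card W"
    unfolding com_def
  proof (rule Suc.hyps(1))
    show "n = card W" using Suc.hyps(2) V by simp
    show "\<exists>x\<in>U. card {y\<in>U. adj x y} < d" if "U \<subseteq> W" "U \<noteq> {}" for U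
      using Suc.prems(2) that V by blast
    show "card {y\<in>W. \<forall>x\<in>A. adj x y} < q" if "A \<subseteq> W" "card A = Suc t" for A
    proof -
      have "card {y\<in>W. \<forall>x\<in>A. adj x y} \<le> card {y\<in>V. \<forall>x\<in>A. adj x y}"
        using fV V by (intro card_mono) auto
      also have "\<dots> < q" using that V by (intro free) auto
      finally show ?thesis .
    qed
  qed (use V in auto)
  \<comment> \<open>A set avoiding \<open>v\<close> can gain only \<open>v\<close> as a common
    neighbour, and only if it lies in \<open>N\<close>; this concerns at most \<open>2 ^ d\<close>
    sets.\<close>
  have "(\<Sum>S\<in>nsets W r. card (com V S) - t)
      \<le> (\<Sum>S\<in>nsets W r. (card (com W S) - t) + (if S \<subseteq> N then 1 else 0))"
  proof (rule sum_mono)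
    fix S assume "S \<in> nsets W r"
    then have S: "S \<subseteq> V" using V by (auto simp: nsets_def)
    have "com V S \<subseteq> com W S" if "\<not> S \<subseteq> N"
      using that S V by (auto simp: com_def N_def)
    then have "card (com V S) \<le> card (com W S)" if "\<not> S \<subseteq> N"
      using that fcom[OF V(3)] by (intro card_mono) auto
    moreover have "card (com V S) \<le> Suc (card (com W S))"
    proof -
      have "com V S \<subseteq> insert v (com W S)" using V by (auto simp: com_def)
      then have "card (com V S) \<le> card (insert v (com W S))"
        using fcom[OF V(3)] by (intro card_mono) auto
      also have "\<dots> \<le> Suc (card (com W S))" by (rule card_insert_le_m1) auto
      finally show ?thesis .
    qed
    ultimately show "card (com V S) - t \<le> (card (com W S) - t) + (if S \<subseteq> N then 1 else 0)"
      by (cases "S \<subseteq> N") (simp_all add: diff_le_mono)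
  qed
  also have "\<dots> = (\<Sum>S\<in>nsets W r. card (com W S) - t) + card {S\<in>nsets W r. S \<subseteq> N}"
    using V(3) by (simp add: sum.distrib sum.If_cases finite_imp_finite_nsets Int_def)
  also have "card {S\<in>nsets W r. S \<subseteq> N} \<le> card (Pow N)"
    using N by (intro card_mono) auto
  also note powN
  finally have old: "(\<Sum>S\<in>nsets W r. card (com V S) - t) \<le> (\<Sum>S\<in>nsets W r. card (com W S) - t) + 2 ^ d"
    by simp
  \<comment> \<open>A set \<open>S\<close> through \<open>v\<close> has its common neighbours in
    \<open>N\<close>. If its excess is positive, some \<open>t + 1\<close> of them form a set
    \<open>T\<close>, and \<open>S\<close> lies in the common neighbourhood of \<open>T\<close>,
    which has fewer than \<open>q\<close> elements. \<open>Ex\<close> collects all candidates for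
    such \<open>S\<close>.\<close>
  define Ex where "Ex = (\<Union>T\<in>{T\<in>Pow N. card T = Suc t}. Pow {y\<in>V. \<forall>x\<in>T. adj x y})"
  have "card Ex \<le> 2 ^ q * card {T\<in>Pow N. card T = Suc t}"
    unfolding Ex_def
  proof (rule card_UN_le_mult)
    fix T assume "T \<in> {T\<in>Pow N. card T = Suc t}"
    then have "card {y\<in>V. \<forall>x\<in>T. adj x y} < q" using N by (intro free) auto
    then show "card (Pow {y\<in>V. \<forall>x\<in>T. adj x y}) \<le> 2 ^ q"
      using fV by (simp add: card_Pow)
  qed (use N in auto)
  also have "card {T\<in>Pow N. card T = Suc t} \<le> card (Pow N)"
    using N by (intro card_mono) auto
  also note powN
  finally have cardEx: "card Ex \<le> 2 ^ d * 2 ^ q" by (simp add: mult.commute)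
  have finEx: "finite Ex" unfolding Ex_def using N fV by auto
  define New where "New = {S\<in>nsets V r. v \<in> S}"
  have finNew: "finite New" unfolding New_def using fV by (auto simp: finite_imp_finite_nsets)
  have comN: "com V S \<subseteq> N" if "S \<in> New" for S
    using that sym by (auto simp: New_def com_def N_def)
  have "(\<Sum>S\<in>New. card (com V S) - t) = (\<Sum>S\<in>New \<inter> Ex. card (com V S) - t)"
  proof (rule sum.mono_neutral_right[OF finNew], simp, rule ballI)
    fix S assume S: "S \<in> New - New \<inter> Ex"
    show "card (com V S) - t = 0"
    proof (rule ccontr)
      assume "card (com V S) - t \<noteq> 0"
      then have "Suc t \<le> card (com V S)" by simp
      then obtain T where T: "T \<subseteq> com V S" "card T = Suc t"
        by (metis obtain_subset_with_card_n)
      moreover have "S \<subseteq> {y\<in>V. \<forall>x\<in>T. adj x y}"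
        using S T by (auto simp: New_def nsets_def com_def)
      moreover have "T \<subseteq> N" using T comN S by blast
      ultimately have "S \<in> Ex" unfolding Ex_def by blast
      with S show False by blast
    qed
  qed
  also have "\<dots> \<le> card (New \<inter> Ex) * d"
  proof -
    have "card (com V S) - t \<le> d" if "S \<in> New" for S
      using card_mono[OF N(1) comN[OF that]] N(2) by simp
    then show ?thesis
      using sum_bounded_above[of "New \<inter> Ex" "\<lambda>S. card (com V S) - t" d] by simp
  qed
  also have "\<dots> \<le> card Ex * d" using finEx by (intro mult_right_mono card_mono) auto
  also have "\<dots> \<le> d * (2 ^ d * 2 ^ q)" using cardEx by (simp add: mult.commute)
  finally have new: "(\<Sum>S\<in>New. card (com V S) - t) \<le> d * (2 ^ d * 2 ^ q)" .
  have split: "nsets V r = nsets W r \<union> New"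
    using V by (auto simp: New_def nsets_def)
  have "(\<Sum>S\<in>nsets V r. card (com V S) - t)
      = (\<Sum>S\<in>nsets W r. card (com V S) - t) + (\<Sum>S\<in>New. card (com V S) - t)"
    unfolding split using V finNew
    by (intro sum.union_disjoint) (auto simp: finite_imp_finite_nsets New_def nsets_def)
  also have "\<dots> \<le> (2 ^ d + d * (2 ^ d * 2 ^ q)) * card W + (2 ^ d + d * (2 ^ d * 2 ^ q))"
    using old new IH by linarith
  also have "\<dots> = (2 ^ d + d * (2 ^ d * 2 ^ q)) * card V"
    using V by simp
  finally show ?case unfolding com_def .
qed


section \<open>Rainbow colourings, homogeneous subfamilies and their intersection patterns\<close>

text \<open>A random colouring with \<open>k\<close> colours is injective on a given edge with
  probability at least \<open>1 / k ^ k\<close>, so some colouring is injective on at least this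
  proportion of the edges.\<close>

lemma ex_rainbow_subfamily:
  assumes "finite V" and F: "F \<subseteq> nsets V k" and "0 < k"
  shows "\<exists>\<chi>. card F \<le> k ^ k * card {e\<in>F. \<chi> ` e \<subseteq> {..<k} \<and> inj_on \<chi> e}"
proof -
  define P where "P = V \<rightarrow>\<^sub>E {..<k}"
  define Q where "Q e = {\<chi>\<in>P. inj_on \<chi> e}" for e
  define G where "G \<chi> = {e\<in>F. inj_on \<chi> e}" for \<chi> :: "'a \<Rightarrow> nat"
  have finP: "finite P" unfolding P_def using \<open>finite V\<close> by (intro finite_PiE) auto
  have finF: "finite F"
    using F finite_imp_finite_nsets[OF \<open>finite V\<close>] by (rule finite_subset)
  have cardP: "card P = k ^ card V" unfolding P_def using \<open>finite V\<close> by (simp add: card_PiE)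
  have PQ: "card P \<le> k ^ k * card (Q e)" if "e \<in> F" for e
  proof -
    have e: "finite e" "card e = k" "e \<subseteq> V" using that F by (auto simp: nsets_def)
    then obtain b where b: "bij_betw b e {..<k}"
      by (metis atLeast0LessThan ex_bij_betw_finite_nat)
    \<comment> \<open>Overwriting the colours on \<open>e\<close> by the bijection \<open>b\<close>
      makes a colouring injective there; recording the lost colours keeps the map injective. This
      yields the factor \<open>k ^ k\<close>.\<close>
    define h where "h \<chi> = (restrict \<chi> e, \<lambda>x. if x \<in> e then b x else \<chi> x)" for \<chi> :: "'a \<Rightarrow> nat"
    have "inj_on h P"
    proof (rule inj_onI)
      fix \<chi> \<psi> assume "h \<chi> = h \<psi>"
      then have eq: "restrict \<chi> e = restrict \<psi> e"
        "(\<lambda>x. if x \<in> e then b x else \<chi> x) = (\<lambda>x. if x \<in> e then b x else \<psi> x)"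
        by (auto simp: h_def)
      show "\<chi> = \<psi>"
      proof
        fix x show "\<chi> x = \<psi> x"
          using fun_cong[OF eq(1), of x] fun_cong[OF eq(2), of x] by (cases "x \<in> e") auto
      qed
    qed
    moreover have "h ` P \<subseteq> (e \<rightarrow>\<^sub>E {..<k}) \<times> Q e"
    proof (rule image_subsetI)
      fix \<chi> assume \<chi>: "\<chi> \<in> P"
      have "(\<lambda>x. if x \<in> e then b x else \<chi> x) \<in> P"
        using \<chi> e b by (auto simp: P_def PiE_iff extensional_def bij_betw_def)
      moreover have "inj_on (\<lambda>x. if x \<in> e then b x else \<chi> x) e"
        using b by (auto simp: bij_betw_def inj_on_def)
      moreover have "restrict \<chi> e \<in> e \<rightarrow>\<^sub>E {..<k}"
        using \<chi> e by (auto simp: P_def PiE_iff)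
      ultimately show "h \<chi> \<in> (e \<rightarrow>\<^sub>E {..<k}) \<times> Q e"
        by (simp add: h_def Q_def)
    qed
    moreover have "finite ((e \<rightarrow>\<^sub>E {..<k}) \<times> Q e)"
      using e finP by (auto simp: Q_def intro!: finite_PiE)
    ultimately have "card P \<le> card ((e \<rightarrow>\<^sub>E {..<k}) \<times> Q e)"
      by (rule card_inj_on_le)
    then show ?thesis using e by (simp add: card_cartesian_product card_PiE)
  qed
  \<comment> \<open>Double counting of the pairs of a colouring and an edge on which it is
    injective.\<close>
  have "(\<Sum>\<chi>\<in>P. card (G \<chi>)) = (\<Sum>e\<in>F. card (Q e))"
    using sum.swap_restrict[OF finP finF, of "\<lambda>_ _. 1::nat" "\<lambda>\<chi> e. inj_on \<chi> e"]
    by (simp add: G_def Q_def)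
  then have "card F * card P \<le> k ^ k * (\<Sum>\<chi>\<in>P. card (G \<chi>))"
    using sum_mono[OF PQ, of F "\<lambda>e. e"] by (simp add: sum_distrib_left)
  moreover have "k ^ k * (\<Sum>\<chi>\<in>P. card (G \<chi>)) < card P * card F"
    if "\<And>\<chi>. \<chi> \<in> P \<Longrightarrow> k ^ k * card (G \<chi>) < card F"
  proof -
    have "P \<noteq> {}" using cardP \<open>0 < k\<close> by (metis card.empty less_numeral_extra(3) zero_less_power)
    then have "(\<Sum>\<chi>\<in>P. k ^ k * card (G \<chi>)) < (\<Sum>\<chi>\<in>P. card F)"
      using that finP by (intro sum_strict_mono) auto
    then show ?thesis by (simp add: sum_distrib_left)
  qed
  ultimately obtain \<chi> where \<chi>: "\<chi> \<in> P" "card F \<le> k ^ k * card (G \<chi>)"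
    by (metis mult.commute not_less)
  have "G \<chi> = {e\<in>F. \<chi> ` e \<subseteq> {..<k} \<and> inj_on \<chi> e}"
    using \<chi>(1) F by (auto simp: G_def P_def PiE_iff nsets_def)
  with \<chi>(2) show ?thesis by auto
qed

text \<open>A colour set \<open>I\<close> thereby names one subset in every rainbow edge, so that
  intersections and kernels in different edges can be compared by their patterns.\<close>

definition coloured_part :: "('a \<Rightarrow> 'c) \<Rightarrow> 'a set \<Rightarrow> 'c set \<Rightarrow> 'a set" where
  "coloured_part \<chi> e I = {x\<in>e. \<chi> x \<in> I}"

lemma coloured_part_subset: "coloured_part \<chi> e I \<subseteq> e"
  by (auto simp: coloured_part_def)

lemma coloured_part_Int:
  "coloured_part \<chi> e I \<inter> coloured_part \<chi> e J = coloured_part \<chi> e (I \<inter> J)"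
  by (auto simp: coloured_part_def)

lemma image_coloured_part: "I \<subseteq> \<chi> ` e \<Longrightarrow> \<chi> ` coloured_part \<chi> e I = I"
  by (auto simp: coloured_part_def)

lemma coloured_part_image:
  assumes "inj_on \<chi> e" "A \<subseteq> e"
  shows "coloured_part \<chi> e (\<chi> ` A) = A"
  using assms by (auto simp: coloured_part_def inj_on_def)

text \<open>As long as some \<open>A = coloured_part \<chi> e I\<close> is not a kernel, all edges through \<open>A\<close> are
  removed.  They meet a fixed set of fewer than \<open>s\<close> vertices outside \<open>A\<close>, so a proportion \<open>1/s\<close>
  of them shares a further vertex and goes to \<open>B I\<close>.\<close>

lemma peel_nonkernels:
  assumes "finite R" and "finite L" and inj: "\<And>e. e \<in> R \<Longrightarrow> inj_on \<chi> e"
    and L: "\<And>e I. e \<in> R \<Longrightarrow> I \<in> L \<Longrightarrow> I \<subseteq> \<chi> ` e"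
  shows "\<exists>H B. H \<subseteq> R \<and> (\<forall>I\<in>L. B I \<subseteq> R) \<and> card R \<le> card H + s * (\<Sum>I\<in>L. card (B I)) \<and>
    (\<forall>e\<in>H. \<forall>I\<in>L. delta_kernel s H (coloured_part \<chi> e I)) \<and>
    (\<forall>I\<in>L. \<forall>e\<in>B I. \<forall>f\<in>B I. \<chi> ` (e \<inter> f) \<noteq> I)"
  using assms(1) inj L
proof (induction R rule: finite_psubset_induct)
  case (psubset R)
  show ?case
  proof (cases "\<forall>e\<in>R. \<forall>I\<in>L. delta_kernel s R (coloured_part \<chi> e I)")
    case True
    then show ?thesis by (intro exI[of _ R] exI[of _ "\<lambda>_. {}"]) auto
  next
    case False
    then obtain e I where e: "e \<in> R" and I: "I \<in> L"
      and nk: "\<not> delta_kernel s R (coloured_part \<chi> e I)" by blast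
    define A where "A = coloured_part \<chi> e I"
    obtain X where X: "finite X" "card X < s" "\<not> (\<exists>f\<in>R. A \<subseteq> f \<and> (f - A) \<inter> X = {})"
      using nk unfolding delta_kernel_def A_def[symmetric] not_all not_imp by (elim exE conjE)
    define Gp where "Gp = {f\<in>R. A \<subseteq> f}"
    have eG: "e \<in> Gp" using e by (auto simp: Gp_def A_def coloured_part_def)
    have finG: "finite Gp" using psubset.hyps by (auto simp: Gp_def)
    have GR: "Gp \<subseteq> R" by (auto simp: Gp_def)
    have "\<exists>x\<in>X - A. card Gp \<le> s * card {f\<in>Gp. x \<in> f}"
    proof (rule ccontr)
      assume "\<not> ?thesis"
      then have less: "s * card {f\<in>Gp. x \<in> f} \<le> card Gp" if "x \<in> X - A" for x
        using that by (auto simp: not_le intro: less_imp_le)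
      have "Gp \<subseteq> (\<Union>x\<in>X - A. {f\<in>Gp. x \<in> f})" using X(3) by (fastforce simp: Gp_def)
      then have "card Gp \<le> card (\<Union>x\<in>X - A. {f\<in>Gp. x \<in> f})"
        using finG X(1) by (intro card_mono) auto
      also have "\<dots> \<le> (\<Sum>x\<in>X - A. card {f\<in>Gp. x \<in> f})"
        using X(1) by (intro card_UN_le) auto
      finally have "s * card Gp \<le> (\<Sum>x\<in>X - A. s * card {f\<in>Gp. x \<in> f})"
        by (simp add: sum_distrib_left[symmetric])
      also have "\<dots> \<le> card (X - A) * card Gp"
        using sum_bounded_above[of "X - A" "\<lambda>x. s * card {f\<in>Gp. x \<in> f}" "card Gp"] less by simp
      also have "\<dots> \<le> card X * card Gp"
        using X(1) by (intro mult_right_mono card_mono) auto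
      also have "\<dots> < s * card Gp"
        using X(2) eG finG by (intro mult_strict_right_mono) (auto simp: card_gt_0_iff)
      finally show False by simp
    qed
    then obtain x where x: "x \<notin> A" "card Gp \<le> s * card {f\<in>Gp. x \<in> f}" by blast
    have "R - Gp \<subset> R" using e eG by blast
    from psubset.IH[OF this] psubset.prems obtain H B where HB: "H \<subseteq> R - Gp" "\<forall>I\<in>L. B I \<subseteq> R - Gp"
      "card (R - Gp) \<le> card H + s * (\<Sum>I\<in>L. card (B I))"
      "\<forall>e\<in>H. \<forall>I\<in>L. delta_kernel s H (coloured_part \<chi> e I)"
      "\<forall>I\<in>L. \<forall>e\<in>B I. \<forall>f\<in>B I. \<chi> ` (e \<inter> f) \<noteq> I"
      by (metis (no_types, lifting) DiffD1)
    define B' where "B' = B(I := B I \<union> {f\<in>Gp. x \<in> f})"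
    have finB: "finite (B J)" if "J \<in> L" for J
      using HB(2) that psubset.hyps by (meson finite_Diff finite_subset)
    have "card (B' I) = card (B I) + card {f\<in>Gp. x \<in> f}"
      unfolding B'_def using HB(2) I finG finB by (auto intro!: card_Un_disjoint)
    then have "(\<Sum>J\<in>L. card (B' J)) = (\<Sum>J\<in>L. card (B J)) + card {f\<in>Gp. x \<in> f}"
      using sum.remove[OF \<open>finite L\<close> I, of "\<lambda>J. card (B' J)"] sum.remove[OF \<open>finite L\<close> I, of "\<lambda>J. card (B J)"]
      by (simp add: B'_def)
    moreover have "card R = card (R - Gp) + card Gp"
      using psubset.hyps GR by (metis card_Diff_subset card_mono finG le_add_diff_inverse2)
    ultimately have count: "card R \<le> card H + s * (\<Sum>I\<in>L. card (B' I))"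
      using HB(3) x(2) by (simp add: algebra_simps)
    \<comment> \<open>Since \<open>g\<close> is rainbow and contains \<open>A\<close>, the only
      subset of \<open>g\<close> with colour set \<open>I\<close> is \<open>A\<close>. Hence
      \<open>f\<close> and \<open>g\<close> meet exactly in \<open>A\<close>, which omits
      \<open>x\<close>.\<close>
    have meet: "A \<subseteq> f \<and> x \<notin> f \<inter> g" if "f \<in> R" "g \<in> Gp" "\<chi> ` (f \<inter> g) = I" for f g
    proof -
      have g: "g \<in> R" "A \<subseteq> g" using that(2) by (auto simp: Gp_def)
      have "\<chi> ` A = I" 
        unfolding A_def by (rule image_coloured_part[OF psubset.prems(2)[OF e I]])
      then have "f \<inter> g = A"
        using coloured_part_image[OF psubset.prems(1)[OF g(1)], of A] 
          coloured_part_image[OF psubset.prems(1)[OF g(1)], of "f \<inter> g"] g(2) that(3) by simp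
      then show ?thesis using x(1) by blast
    qed
    have free: "\<chi> ` (f \<inter> g) \<noteq> I" if f: "f \<in> B' I" and g: "g \<in> B' I" for f g
    proof
      assume eq: "\<chi> ` (f \<inter> g) = I"
      have mem: "h \<in> R" "h \<in> Gp \<longleftrightarrow> A \<subseteq> h" "h \<in> B I \<or> h \<in> Gp \<and> x \<in> h" if "h \<in> B' I" for h
        using that HB(2) I by (auto simp: B'_def Gp_def)
      consider "f \<in> B I" "g \<in> B I" | "g \<in> Gp" "x \<in> g" | "f \<in> Gp" "x \<in> f"
        using mem(3)[OF f] mem(3)[OF g] by blast
      \<comment> \<open>If one of the two edges is new, the other contains \<open>A\<close> as well,
        so it lies in \<open>Gp\<close>. It is therefore not an old member of \<open>B I\<close>,
        and both edges contain \<open>x\<close>, contrary to \<open>meet\<close>.\<close>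
      then show False
      proof cases
        case 1
        then show ?thesis using HB(5) I eq by blast
      next
        case 2
        from meet[OF mem(1)[OF f] 2(1) eq] have "f \<in> Gp" "x \<notin> f"
          using mem(2)[OF f] 2(2) by auto
        then show ?thesis using mem(3)[OF f] HB(2) I by auto
      next
        case 3
        from meet[OF mem(1)[OF g] 3(1)] eq have "g \<in> Gp" "x \<notin> g"
          using mem(2)[OF g] 3(2) by (auto simp: Int_commute)
        then show ?thesis using mem(3)[OF g] HB(2) I by auto
      qed
    qed
    show ?thesis
    proof (intro exI[of _ H] exI[of _ B'] conjI count)
      show "H \<subseteq> R" using HB(1) by blast
      show "\<forall>I\<in>L. B' I \<subseteq> R" using HB(2) GR by (auto simp: B'_def)
      show "\<forall>e\<in>H. \<forall>I\<in>L. delta_kernel s H (coloured_part \<chi> e I)" by (rule HB(4))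
      show "\<forall>I\<in>L. \<forall>e\<in>B' I. \<forall>f\<in>B' I. \<chi> ` (e \<inter> f) \<noteq> I"
      proof (intro ballI)
        fix J f g assume "J \<in> L" "f \<in> B' J" "g \<in> B' J"
        then show "\<chi> ` (f \<inter> g) \<noteq> J"
          using free HB(5) by (cases "J = I") (auto simp: B'_def)
      qed
    qed
  qed
qed

text \<open>Furedi's theorem on homogeneous subfamilies. The set \<open>L\<close> holds the colour sets that may still
  occur as intersections; if removing nonkernels destroys most of \<open>R\<close>, then some \<open>B I\<close> of
  peel_nonkernels is large, and it does not use \<open>I\<close> any more.\<close>

lemma ex_homogeneous_subfamily:
  assumes "finite R" and "finite L" and "card L \<le> N" and inj: "\<And>e. e \<in> R \<Longrightarrow> inj_on \<chi> e"
    and L: "\<And>e I. e \<in> R \<Longrightarrow> I \<in> L \<Longrightarrow> I \<subseteq> \<chi> ` e"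
    and int: "\<And>e f. e \<in> R \<Longrightarrow> f \<in> R \<Longrightarrow> e \<noteq> f \<Longrightarrow> \<chi> ` (e \<inter> f) \<in> L"
  shows "\<exists>R'\<subseteq>R. \<exists>L'\<subseteq>L. card R \<le> (2 * s * N + 2) ^ Suc (card L) * card R' \<and>
    (\<forall>e\<in>R'. \<forall>f\<in>R'. e \<noteq> f \<longrightarrow> \<chi> ` (e \<inter> f) \<in> L') \<and>
    (\<forall>e\<in>R'. \<forall>I\<in>L'. delta_kernel s R' (coloured_part \<chi> e I))"
  using assms
proof (induction "card L" arbitrary: L R rule: less_induct)
  case less
  \<comment> \<open>If \<open>H\<close> keeps half of \<open>R\<close>, a factor 2 is lost;
    otherwise the largest of the at most \<open>N\<close> families \<open>B I\<close> keeps a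
    proportion \<open>1 / (2 * s * N)\<close>. Either loss is at most \<open>c\<close>.\<close>
  define c where "c = 2 * s * N + 2"
  obtain H B where HB: "H \<subseteq> R" "\<forall>I\<in>L. B I \<subseteq> R"
      "card R \<le> card H + s * (\<Sum>I\<in>L. card (B I))"
      "\<forall>e\<in>H. \<forall>I\<in>L. delta_kernel s H (coloured_part \<chi> e I)"
      "\<forall>I\<in>L. \<forall>e\<in>B I. \<forall>f\<in>B I. \<chi> ` (e \<inter> f) \<noteq> I"
    using peel_nonkernels[OF less.prems(1,2), of \<chi> s] less.prems(4,5) by auto
  show ?case
  proof (cases "card R \<le> 2 * card H")
    case True
    have "2 \<le> c" by (simp add: c_def)
    also have "c \<le> c ^ Suc (card L)" using \<open>2 \<le> c\<close> by (intro self_le_power) auto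
    finally have "card R \<le> c ^ Suc (card L) * card H"
      using True mult_right_mono[of 2 "c ^ Suc (card L)" "card H"] by linarith
    moreover have "\<forall>e\<in>H. \<forall>f\<in>H. e \<noteq> f \<longrightarrow> \<chi> ` (e \<inter> f) \<in> L"
      using HB(1) less.prems(6) by (meson subsetD)
    ultimately show ?thesis
      using HB(1,4) unfolding c_def by (meson subset_refl)
  next
    case False
    then have large: "card R \<le> 2 * (s * (\<Sum>I\<in>L. card (B I)))" using HB(3) by linarith
    have "L \<noteq> {}" using False large by auto
    define M where "M = Max ((\<lambda>I. card (B I)) ` L)"
    have "M \<in> (\<lambda>I. card (B I)) ` L"
      unfolding M_def using \<open>L \<noteq> {}\<close> less.prems(2) by (intro Max_in) auto
    then obtain I where I: "I \<in> L" "card (B I) = M" by auto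
    have "(\<Sum>I\<in>L. card (B I)) \<le> card L * M"
      using sum_bounded_above[of L "\<lambda>I. card (B I)" M] less.prems(2) by (auto simp: M_def)
    also have "\<dots> \<le> N * card (B I)" using less.prems(3) I by simp
    finally have "card R \<le> 2 * (s * (N * card (B I)))"
      using large by (meson le_trans mult_le_mono2)
    then have RB: "card R \<le> c * card (B I)" by (simp add: c_def algebra_simps)
    have BR: "B I \<subseteq> R" using HB(2) I by blast
    have cL: "Suc (card (L - {I})) = card L" using I less.prems(2) by (metis card.remove)
    have "\<exists>R'\<subseteq>B I. \<exists>L'\<subseteq>L - {I}. card (B I) \<le> c ^ Suc (card (L - {I})) * card R' \<and>
      (\<forall>e\<in>R'. \<forall>f\<in>R'. e \<noteq> f \<longrightarrow> \<chi> ` (e \<inter> f) \<in> L') \<and>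
      (\<forall>e\<in>R'. \<forall>I\<in>L'. delta_kernel s R' (coloured_part \<chi> e I))"
      unfolding c_def
    proof (rule less.hyps)
      show "finite (B I)" using BR less.prems(1) finite_subset by blast
      show "\<chi> ` (e \<inter> f) \<in> L - {I}" if "e \<in> B I" "f \<in> B I" "e \<noteq> f" for e f
      proof
        show "\<chi> ` (e \<inter> f) \<in> L" using that BR by (intro less.prems(6)) auto
        show "\<chi> ` (e \<inter> f) \<notin> {I}" using HB(5) I(1) that(1,2) by auto
      qed
      show "J \<subseteq> \<chi> ` e" if "e \<in> B I" "J \<in> L - {I}" for e J
        using that BR by (intro less.prems(5)) auto
      show "inj_on \<chi> e" if "e \<in> B I" for e
        using that BR by (intro less.prems(4)) auto
    qed (use cL less.prems(2,3) in auto)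
    then obtain R' L' where R': "R' \<subseteq> B I" "L' \<subseteq> L - {I}" "card (B I) \<le> c ^ card L * card R'"
      "\<forall>e\<in>R'. \<forall>f\<in>R'. e \<noteq> f \<longrightarrow> \<chi> ` (e \<inter> f) \<in> L'"
      "\<forall>e\<in>R'. \<forall>I\<in>L'. delta_kernel s R' (coloured_part \<chi> e I)"
      unfolding cL by (elim exE conjE)
    have "card R \<le> c * (c ^ card L * card R')"
      using RB mult_le_mono2[OF R'(3), of c] by (rule le_trans)
    then have "card R \<le> c ^ Suc (card L) * card R'" by (simp add: mult.assoc)
    then show ?thesis
      using R' BR unfolding c_def by (intro exI[of _ R'] exI[of _ L'] conjI) auto
  qed
qed

text \<open>The complements of members of \<open>L\<close> are closed under unions, and any two points whose
  singletons are not such complements form one together. Hence every nonempty set that does not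
  contain exactly one of these points is the complement of a member of \<open>L\<close>.\<close>

lemma singletons_or_centre:
  fixes k :: nat
  assumes "4 \<le> k" and proper: "\<And>I. I \<in> L \<Longrightarrow> I \<subset> {..<k}"
    and closed: "\<And>I J. I \<in> L \<Longrightarrow> J \<in> L \<Longrightarrow> I \<inter> J \<in> L"
    and cover: "\<And>i j. i < k \<Longrightarrow> j < k \<Longrightarrow> i \<noteq> j \<Longrightarrow> \<exists>I\<in>L. {..<k} - {i, j} \<subseteq> I"
  shows "(\<exists>i<k. \<exists>j<k. i \<noteq> j \<and> {i} \<in> L \<and> {j} \<in> L) \<or> (\<exists>c<k. \<forall>j<k. j \<noteq> c \<longrightarrow> {c, j} \<in> L)"
proof -
  define D where "D T \<longleftrightarrow> {..<k} - T \<in> L" for T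
  define U where "U = {x\<in>{..<k}. \<not> D {x}}"
  have Dun: "D (S \<union> T)" if "D S" "D T" for S T
    using closed[of "{..<k} - S" "{..<k} - T"] that by (simp add: D_def Diff_Un)
  \<comment> \<open>The complement of a proper \<open>I\<close> containing all colours but
    \<open>i\<close> and \<open>j\<close> is \<open>{i}\<close>, \<open>{j}\<close> or
    \<open>{i, j}\<close>, and membership in \<open>U\<close> excludes the first two.\<close>
  have D2: "D {i, j}" if "i \<in> U" "j \<in> U" "i \<noteq> j" for i j
  proof -
    have ij: "i < k" "j < k" using that by (auto simp: U_def)
    obtain I where I: "I \<in> L" "{..<k} - {i, j} \<subseteq> I" using cover[OF ij \<open>i \<noteq> j\<close>] by blast
    have "I = {..<k} - {i} \<or> I = {..<k} - {j} \<or> I = {..<k} - {i, j}"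
      using proper[OF I(1)] I(2) ij by blast
    then show ?thesis using I(1) \<open>i \<in> U\<close> \<open>j \<in> U\<close> by (auto simp: U_def D_def)
  qed
  \<comment> \<open>Such a \<open>T\<close> is a union of singletons outside \<open>U\<close> and of
    pairs inside \<open>U\<close>, because no point of \<open>U\<close> is left without a
    partner.\<close>
  have DT: "D T" if T: "T \<subseteq> {..<k}" "T \<noteq> {}" "card (T \<inter> U) \<noteq> 1" for T
  proof -
    have finT: "finite T" using T(1) finite_subset by blast
    have "\<exists>T'\<subseteq>T. x \<in> T' \<and> D T'" if "x \<in> T" for x
    proof (cases "x \<in> U")
      case True
      then have "T \<inter> U \<noteq> {x}" using T(3) by auto
      then obtain y where "y \<in> T" "y \<in> U" "y \<noteq> x" using True \<open>x \<in> T\<close> by blast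
      then show ?thesis using D2[of x y] True \<open>x \<in> T\<close> by (intro exI[of _ "{x, y}"]) auto
    next
      case False
      then show ?thesis using T(1) \<open>x \<in> T\<close> by (intro exI[of _ "{x}"]) (auto simp: U_def)
    qed
    then obtain g where g: "\<And>x. x \<in> T \<Longrightarrow> g x \<subseteq> T \<and> x \<in> g x \<and> D (g x)" by metis
    have "D (\<Union>x\<in>A. g x)" if "finite A" "A \<noteq> {}" "A \<subseteq> T" for A
      using that by (induction rule: finite_ne_induct) (auto simp: g Dun)
    from this[OF finT T(2)] have "D (\<Union>x\<in>T. g x)" by simp
    moreover have "(\<Union>x\<in>T. g x) = T" using g by blast
    ultimately show ?thesis by simp
  qed
  have sing: "{v} \<in> L" if "v < k" "card (U - {v}) \<noteq> 1" for v
  proof -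
    have "D ({..<k} - {v})"
    proof (rule DT)
      have "card ({..<k} - {v}) = k - 1" using that(1) by simp
      then show "{..<k} - {v} \<noteq> {}" using \<open>4 \<le> k\<close> by (intro notI) simp
      have "({..<k} - {v}) \<inter> U = U - {v}" by (auto simp: U_def)
      then show "card (({..<k} - {v}) \<inter> U) \<noteq> 1" using that(2) by simp
    qed auto
    moreover have "{..<k} - ({..<k} - {v}) = {v}" using that(1) by auto
    ultimately show ?thesis by (simp add: D_def)
  qed
  have finU: "finite U" "U \<subseteq> {..<k}" by (auto simp: U_def)
  show ?thesis
  proof (cases "card U \<le> 1")
    case True
    \<comment> \<open>The centre is the single point of \<open>U\<close>, or an arbitrary colour if
      \<open>U\<close> is empty; the complement of \<open>{c, j}\<close> then misses
      \<open>U\<close>.\<close>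
    have "\<exists>c<k. U \<subseteq> {c}"
    proof (cases "U = {}")
      case True
      then show ?thesis using \<open>4 \<le> k\<close> by (intro exI[of _ 0]) auto
    next
      case False
      then have "card U = 1" using True finU by (simp add: le_Suc_eq)
      then show ?thesis using finU(2) by (auto simp: card_1_singleton_iff)
    qed
    then obtain c where c: "c < k" "U \<subseteq> {c}" by blast
    have "{c, j} \<in> L" if "j < k" "j \<noteq> c" for j
    proof -
      have "card ({..<k} - {c, j}) = k - 2"
        using c that by (subst card_Diff_subset) auto
      then have "{..<k} - {c, j} \<noteq> {}" using \<open>4 \<le> k\<close> by (intro notI) simp
      moreover have "({..<k} - {c, j}) \<inter> U = {}" using c by auto
      ultimately have "D ({..<k} - {c, j})" by (intro DT) auto
      moreover have "{..<k} - ({..<k} - {c, j}) = {c, j}" using c that by auto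
      ultimately show ?thesis by (simp add: D_def)
    qed
    with c(1) show ?thesis by blast
  next
    case False
    then have U2: "2 \<le> card U" by simp
    have two: "\<exists>i\<in>A. \<exists>j\<in>A. i \<noteq> j" if "2 \<le> card A" "finite A" for A :: "nat set"
      using that card_le_Suc0_iff_eq[of A] by auto
    \<comment> \<open>Two points outside \<open>U\<close> leave all of \<open>U\<close>. If there
      are not two, \<open>U\<close> has at least \<open>k - 1\<close>, hence at least 3, points, and
      any point of \<open>U\<close> may be deleted.\<close>
    have "\<exists>i<k. \<exists>j<k. i \<noteq> j \<and> card (U - {i}) \<noteq> 1 \<and> card (U - {j}) \<noteq> 1"
    proof (cases "2 \<le> card ({..<k} - U)")
      case True
      then obtain i j where "i \<in> {..<k} - U" "j \<in> {..<k} - U" "i \<noteq> j"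
        using two[of "{..<k} - U"] by auto
      then show ?thesis using U2 by (intro exI[of _ i] conjI exI[of _ j]) auto
    next
      case False
      then have "3 \<le> card U" using finU \<open>4 \<le> k\<close> by (simp add: card_Diff_subset)
      moreover obtain i j where "i \<in> U" "j \<in> U" "i \<noteq> j"
        using two[OF U2] finU by auto
      ultimately show ?thesis using finU by (intro exI[of _ i] conjI exI[of _ j]) auto
    qed
    with sing show ?thesis by blast
  qed
qed


section \<open>Counting edges without and with a centre\<close>

text \<open>Passing to a rainbow and then to a homogeneous family \<open>R'\<close> costs constant
  factors only. If \<open>R'\<close> had more than \<open>card V choose (k - 2)\<close> edges,
  \<open>singletons_or_centre\<close> would apply to its patterns \<open>L'\<close>: two singletons
  give a path, and a centre colour contradicts \<open>nocentre\<close>.\<close>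

lemma card_without_centre_le:
  assumes "4 \<le> k" and "finite V" and F: "F \<subseteq> nsets V k" and s: "2 * k * (l + 2) < s"
    and nopath: "\<not> (\<exists>P\<subseteq>F. linear_path k l P)"
    and nocentre: "\<And>e x. e \<in> F \<Longrightarrow> x \<in> e \<Longrightarrow> \<exists>y\<in>e - {x}. \<not> delta_kernel s F {x, y}"
  shows "card F \<le> k ^ k * ((2 * s * 2 ^ k + 2) ^ Suc (2 ^ k) * (card V choose (k - 2)))"
proof -
  define c where "c = 2 * s * 2 ^ k + 2"
  obtain \<chi> where \<chi>: "card F \<le> k ^ k * card {e\<in>F. \<chi> ` e \<subseteq> {..<k} \<and> inj_on \<chi> e}"
    using ex_rainbow_subfamily[OF \<open>finite V\<close> F] \<open>4 \<le> k\<close> by auto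
  define R where "R = {e\<in>F. \<chi> ` e \<subseteq> {..<k} \<and> inj_on \<chi> e}"
  have finF: "finite F"
    using F finite_imp_finite_nsets[OF \<open>finite V\<close>] by (rule finite_subset)
  have R: "finite e" "card e = k" "e \<subseteq> V" "inj_on \<chi> e" "\<chi> ` e = {..<k}" if "e \<in> R" for e
  proof -
    show e: "finite e" "card e = k" "e \<subseteq> V" "inj_on \<chi> e" using that F by (auto simp: R_def nsets_def)
    then show "\<chi> ` e = {..<k}"
      using that by (intro card_subset_eq) (auto simp: R_def card_image)
  qed
  define L where "L = Pow {..<k} - {{..<k}}"
  have L: "finite L" "card L \<le> 2 ^ k" 
    using card_mono[of "Pow {..<k}" L] by (auto simp: L_def card_Pow)
  have proper: "\<chi> ` A \<in> L" if "e \<in> R" "A \<subseteq> e" "card A < k" for e A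
  proof -
    have "\<chi> ` A \<subseteq> {..<k}" using R(5)[OF that(1)] that(2) by blast
    moreover have "card (\<chi> ` A) < k"
      using that R(1)[OF that(1)] by (meson card_image_le finite_subset le_less_trans)
    ultimately show ?thesis by (auto simp: L_def)
  qed
  have Intless: "card (e \<inter> f) < k" if "e \<in> R" "f \<in> R" "e \<noteq> f" for e f
  proof -
    have "e \<inter> f \<subset> e" using R[OF that(1)] R[OF that(2)] that(3)
      by (metis Int_lower1 Int_lower2 card_subset_eq psubsetI)
    then show ?thesis using R[OF that(1)] by (metis psubset_card_mono)
  qed
  obtain R' L' where R': "R' \<subseteq> R" and L': "L' \<subseteq> L" and card: "card R \<le> c ^ Suc (card L) * card R'"
    and int': "\<forall>e\<in>R'. \<forall>f\<in>R'. e \<noteq> f \<longrightarrow> \<chi> ` (e \<inter> f) \<in> L'"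
    and ker': "\<forall>e\<in>R'. \<forall>I\<in>L'. delta_kernel s R' (coloured_part \<chi> e I)"
  proof -
    have "\<exists>R'\<subseteq>R. \<exists>L'\<subseteq>L. card R \<le> c ^ Suc (card L) * card R' \<and>
      (\<forall>e\<in>R'. \<forall>f\<in>R'. e \<noteq> f \<longrightarrow> \<chi> ` (e \<inter> f) \<in> L') \<and>
      (\<forall>e\<in>R'. \<forall>I\<in>L'. delta_kernel s R' (coloured_part \<chi> e I))"
      unfolding c_def
    proof (rule ex_homogeneous_subfamily)
      show "finite R" using finF by (simp add: R_def)
      show "I \<subseteq> \<chi> ` e" if "e \<in> R" "I \<in> L" for e I
        using R(5)[OF that(1)] that(2) by (auto simp: L_def)
      show "\<chi> ` (e \<inter> f) \<in> L" if "e \<in> R" "f \<in> R" "e \<noteq> f" for e f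
        using proper[OF that(1) _ Intless[OF that]] by simp
    qed (use L R in auto)
    then show thesis by (elim exE conjE) (rule that)
  qed
  have int: "\<chi> ` (e \<inter> f) \<in> L'" if "e \<in> R'" "f \<in> R'" "e \<noteq> f" for e f
    using int' that by simp
  have ker: "delta_kernel s R' (coloured_part \<chi> e I)" if "e \<in> R'" "I \<in> L'" for e I
    using ker' that by simp
  have R'F: "R' \<subseteq> F" using R' by (auto simp: R_def)
  have R'k: "R' \<subseteq> nsets UNIV k" using R'F F by (auto simp: nsets_def)
  have "card R' \<le> card V choose (k - 2)"
  proof (rule ccontr)
    assume big: "\<not> ?thesis"
    then obtain e0 where e0: "e0 \<in> R'" by (cases "R' = {}") auto
    have part_sing: "\<exists>x\<in>e. \<chi> x = i \<and> coloured_part \<chi> e {i} = {x}" if "e \<in> R'" and ik: "i < k" for e i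
    proof -
      have e: "e \<in> R" using that R' by blast
      then obtain x where x: "x \<in> e" "\<chi> x = i" using R(5)[OF e] ik by (metis imageE lessThan_iff)
      then have "coloured_part \<chi> e {i} = {x}"
        using coloured_part_image[OF R(4)[OF e], of "{x}"] by simp
      with x show ?thesis by blast
    qed
    have "(\<exists>i<k. \<exists>j<k. i \<noteq> j \<and> {i} \<in> L' \<and> {j} \<in> L') \<or> (\<exists>c<k. \<forall>j<k. j \<noteq> c \<longrightarrow> {c, j} \<in> L')"
    proof (rule singletons_or_centre[OF \<open>4 \<le> k\<close>])
      show "I \<subset> {..<k}" if "I \<in> L'" for I
        using that L' by (auto simp: L_def)
      show "I \<inter> J \<in> L'" if "I \<in> L'" "J \<in> L'" for I J
      proof -
        \<comment> \<open>The parts of \<open>e0\<close> with patterns \<open>I\<close> and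
          \<open>J\<close> expand to two edges that meet exactly in the pattern
          \<open>I \<inter> J\<close>; this is proper, so the edges differ and homogeneity applies.
          Indexing by booleans also covers \<open>I = J\<close>.\<close>
        let ?K = "\<lambda>b. coloured_part \<chi> e0 (if b then I else J)"
        have "2 * k * card (UNIV :: bool set) < s"
          using s \<open>4 \<le> k\<close> by (simp add: algebra_simps)
        moreover have "delta_kernel s R' (?K b)" for b using ker[OF e0] that by simp
        ultimately obtain E where E: "\<forall>b\<in>UNIV. E b \<in> R' \<and> ?K b \<subseteq> E b"
          "\<forall>b\<in>UNIV. \<forall>b'\<in>UNIV. b \<noteq> b' \<longrightarrow> E b \<inter> E b' = ?K b \<inter> ?K b'"
          using expand_kernels[of "UNIV :: bool set" R' k s ?K] R'k by auto
        have meet: "E True \<inter> E False = coloured_part \<chi> e0 (I \<inter> J)"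
          using E(2)[rule_format, of True False] by (simp add: coloured_part_Int)
        have IJ: "I \<inter> J \<subset> {..<k}" using that L' by (auto simp: L_def)
        have img: "\<chi> ` coloured_part \<chi> e0 (I \<inter> J) = I \<inter> J"
          using IJ R(5) e0 R' by (intro image_coloured_part) blast
        have "E True \<noteq> E False"
        proof
          assume "E True = E False"
          then have "\<chi> ` E True = I \<inter> J" using meet img by simp
          then show False using IJ R(5)[of "E True"] E(1) R' by blast
        qed
        then show ?thesis using int[of "E True" "E False"] E(1) meet img by simp
      qed
      show "\<exists>I\<in>L'. {..<k} - {i, j} \<subseteq> I" if "i < k" "j < k" "i \<noteq> j" for i j
      proof -
        \<comment> \<open>By pigeonhole two edges of \<open>R'\<close> share their part coloured by
          \<open>?T\<close>, and the pattern of their intersection is the required member of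
          \<open>L'\<close>.\<close>
        let ?T = "{..<k} - {i, j}"
        have T: "card ?T = k - 2" using that by (subst card_Diff_subset) auto
        have "coloured_part \<chi> e ?T \<in> nsets V (k - 2)" if "e \<in> R'" for e
        proof -
          have e: "e \<in> R" using that R' by blast
          have "\<chi> ` coloured_part \<chi> e ?T = ?T"
            using R(5)[OF e] by (intro image_coloured_part) auto
          moreover have "inj_on \<chi> (coloured_part \<chi> e ?T)"
            using R(4)[OF e] coloured_part_subset by (rule inj_on_subset)
          ultimately have "card (coloured_part \<chi> e ?T) = k - 2" using T by (metis card_image)
          moreover have "coloured_part \<chi> e ?T \<subseteq> V" "finite (coloured_part \<chi> e ?T)"
            using R(1,3)[OF e] coloured_part_subset[of \<chi> e ?T] by (auto intro: finite_subset)
          ultimately show ?thesis by (simp add: nsets_def)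
        qed
        then have "(\<lambda>e. coloured_part \<chi> e ?T) ` R' \<subseteq> nsets V (k - 2)" by blast
        moreover have "card (nsets V (k - 2)) < card R'" using big by (simp add: card_nsets)
        moreover have "finite (nsets V (k - 2))" using \<open>finite V\<close> by (rule finite_imp_finite_nsets)
        ultimately have "\<not> inj_on (\<lambda>e. coloured_part \<chi> e ?T) R'"
          using card_inj_on_le by (metis not_less)
        then obtain e f where ef: "e \<in> R'" "f \<in> R'" "e \<noteq> f"
          "coloured_part \<chi> e ?T = coloured_part \<chi> f ?T" by (auto simp: inj_on_def)
        have "?T \<subseteq> \<chi> ` e" using R(5)[of e] ef(1) R' by auto
        then have "\<chi> ` coloured_part \<chi> e ?T = ?T" by (rule image_coloured_part)
        moreover have "coloured_part \<chi> e ?T \<subseteq> e \<inter> f"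
          using ef(4) coloured_part_subset by (metis Int_greatest)
        ultimately have "?T \<subseteq> \<chi> ` (e \<inter> f)" by (metis image_mono)
        then show ?thesis using int[OF ef(1-3)] by blast
      qed
    qed
    then show False
    proof (elim disjE exE conjE)
      fix i j assume ij: "i < k" "j < k" "i \<noteq> j" "{i} \<in> L'" "{j} \<in> L'"
      have "\<exists>P\<subseteq>R'. linear_path k l P"
      proof (rule linear_path_of_singleton_kernels[OF R'k])
        show "\<exists>x\<in>e. \<exists>y\<in>e. x \<noteq> y \<and> delta_kernel s R' {x} \<and> delta_kernel s R' {y}" if eR': "e \<in> R'" for e
        proof -
          obtain x where x: "x \<in> e" "\<chi> x = i" "coloured_part \<chi> e {i} = {x}"
            using part_sing[OF eR' ij(1)] by blast
          obtain y where y: "y \<in> e" "\<chi> y = j" "coloured_part \<chi> e {j} = {y}"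
            using part_sing[OF eR' ij(2)] by blast
          have "delta_kernel s R' {x}" "delta_kernel s R' {y}" "x \<noteq> y"
            using ker[OF eR' ij(4)] ker[OF eR' ij(5)] x y ij(3) by auto
          with x(1) y(1) show ?thesis by blast
        qed
        show "k * l < s" using s by (simp add: algebra_simps)
      qed (use e0 in auto)
      then show False using nopath R'F by blast
    next
      fix a assume a: "a < k" "\<forall>j<k. j \<noteq> a \<longrightarrow> {a, j} \<in> L'"
      obtain x where x: "x \<in> e0" "\<chi> x = a" using part_sing[OF e0 a(1)] by blast
      have e: "e0 \<in> R" using e0 R' by blast
      have "delta_kernel s F {x, y}" if "y \<in> e0 - {x}" for y
      proof -
        have "\<chi> y < k" "\<chi> y \<noteq> a"
          using R(4,5)[OF e] that x by (auto simp: inj_on_def)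
        then have "delta_kernel s R' (coloured_part \<chi> e0 {a, \<chi> y})"
          using a(2) ker[OF e0] by blast
        moreover have "coloured_part \<chi> e0 (\<chi> ` {x, y}) = {x, y}"
          using R(4)[OF e] x(1) that by (intro coloured_part_image) auto
        ultimately show ?thesis using x(2) kernel_mono[OF _ R'F] by simp
      qed
      then show False using nocentre[of e0 x] x(1) e0 R'F by blast
    qed
  qed
  then have "card R \<le> c ^ Suc (card L) * (card V choose (k - 2))"
    using card by (meson le_trans mult_le_mono2)
  also have "\<dots> \<le> c ^ Suc (2 ^ k) * (card V choose (k - 2))"
    using L by (intro mult_right_mono power_increasing) (auto simp: c_def)
  finally show ?thesis
    using \<chi> unfolding R_def c_def by (meson le_trans mult_le_mono2)
qed

text \<open>An edge is recovered from a chosen centre and the remaining \<open>r\<close>-set, of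
  which the centre is a common neighbour. So the edges inject into such pairs, and each
  \<open>r\<close>-set accounts for at most \<open>t\<close> of them plus its excess.\<close>

lemma card_with_centre_le:
  fixes adj :: "'a \<Rightarrow> 'a \<Rightarrow> bool"
  assumes "finite V" and F: "F \<subseteq> nsets V (Suc r)"
    and centre: "\<And>e. e \<in> F \<Longrightarrow> \<exists>x\<in>e. \<forall>y\<in>e - {x}. adj x y"
  shows "card F \<le> t * (card V choose r) + (\<Sum>S\<in>nsets V r. card {x\<in>V. \<forall>y\<in>S. adj x y} - t)"
proof -
  obtain z where z: "\<And>e. e \<in> F \<Longrightarrow> z e \<in> e \<and> (\<forall>y\<in>e - {z e}. adj (z e) y)"
    using centre by metis
  define P where "P = (SIGMA S:nsets V r. {x\<in>V. \<forall>y\<in>S. adj x y})"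
  have "finite (nsets V r)" using \<open>finite V\<close> by (rule finite_imp_finite_nsets)
  have "card F \<le> card P"
  proof (rule card_inj_on_le)
    show "inj_on (\<lambda>e. (e - {z e}, z e)) F"
      using z by (intro inj_onI) (metis insert_Diff prod.inject)
    show "(\<lambda>e. (e - {z e}, z e)) ` F \<subseteq> P"
      using z F by (fastforce simp: P_def nsets_def)
    show "finite P" unfolding P_def using \<open>finite V\<close> finite_imp_finite_nsets by (intro finite_SigmaI) auto
  qed
  also have "card P = (\<Sum>S\<in>nsets V r. card {x\<in>V. \<forall>y\<in>S. adj x y})"
    unfolding P_def using \<open>finite V\<close> \<open>finite (nsets V r)\<close> by simp
  also have "\<dots> \<le> (\<Sum>S\<in>nsets V r. t + (card {x\<in>V. \<forall>y\<in>S. adj x y} - t))"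
    by (intro sum_mono) simp
  also have "\<dots> = t * (card V choose r) + (\<Sum>S\<in>nsets V r. card {x\<in>V. \<forall>y\<in>S. adj x y} - t)"
    by (simp add: sum.distrib card_nsets)
  finally show ?thesis .
qed

section \<open>Combining the two counts\<close>

lemma card_le_if_no_path_no_blowup:
  assumes "4 \<le> k"
  shows "\<exists>C. \<forall>V F. finite V \<longrightarrow> (V :: 'a set) \<noteq> {} \<longrightarrow> F \<subseteq> nsets V k \<longrightarrow> \<not> (\<exists>P\<subseteq>F. linear_path k l P) \<longrightarrow>
    \<not> contains_copy F (blowup k (complete_bipartite (t + 1) q)) \<longrightarrow>
    card F \<le> t * (card V choose (k - 1)) + C * card V ^ (k - 2)"
proof -
  \<comment> \<open>The summand \<open>l + 2\<close> allows for a path of \<open>l\<close> edges and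
    for expanding two kernels at once, \<open>(t + 1) * q\<close> for the edges of the bipartite
    graph.\<close>
  define s where "s = 2 * k * (l + 2 + (t + 1) * q) + 1"
  \<comment> \<open>\<open>C1\<close> comes from \<open>sum_excess_common_neighbours_le\<close> with
    \<open>d = l\<close>, \<open>C2\<close> from \<open>card_without_centre_le\<close>.\<close>
  define C1 :: nat where "C1 = 2 ^ l + l * (2 ^ l * 2 ^ q)"
  define C2 where "C2 = k ^ k * (2 * s * 2 ^ k + 2) ^ Suc (2 ^ k)"
  have s: "2 * k * (l + 2) < s" "2 * k * ((t + 1) * q) < s" "2 * k * l < s"
    by (auto simp: s_def algebra_simps)
  have "card F \<le> t * (card V choose (k - 1)) + (C1 + C2) * card V ^ (k - 2)"
    if V: "finite V" "V \<noteq> {}" and F: "F \<subseteq> nsets V k"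
      and nopath: "\<not> (\<exists>P\<subseteq>F. linear_path k l P)"
      and noblow: "\<not> contains_copy F (blowup k (complete_bipartite (t + 1) q))"
    for V :: "'a set" and F
  proof -
    define adj where "adj x y \<longleftrightarrow> x \<noteq> y \<and> delta_kernel s F {x, y}" for x y
    define A where "A = {e\<in>F. \<exists>x\<in>e. \<forall>y\<in>e - {x}. adj x y}"
    have Fk: "F \<subseteq> nsets UNIV k" using F by (auto simp: nsets_def)
    have finF: "finite F" using F finite_imp_finite_nsets[OF V(1)] by (rule finite_subset)
    have noadjpath: "\<not> (\<exists>v. inj_on v {..l} \<and> (\<forall>i<l. adj (v i) (v (Suc i))))"
    proof
      assume "\<exists>v. inj_on v {..l} \<and> (\<forall>i<l. adj (v i) (v (Suc i)))"
      then obtain v where "inj_on v {..l}" "\<forall>i<l. adj (v i) (v (Suc i))" by blast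
      then have "\<exists>P\<subseteq>F. linear_path k l P"
        using s(3) by (intro linear_path_of_kernel_path[OF Fk]) (auto simp: adj_def)
      with nopath show False ..
    qed
    have excess: "(\<Sum>S\<in>nsets V (k - 1). card {x\<in>V. \<forall>y\<in>S. adj x y} - t) \<le> C1 * card V"
      unfolding C1_def
    proof (rule sum_excess_common_neighbours_le[OF V(1)])
      show "0 < k - 1" using \<open>4 \<le> k\<close> by simp
      show "adj y x" if "adj x y" for x y using that by (auto simp: adj_def insert_commute)
      show irrefl: "\<not> adj x x" for x by (simp add: adj_def)
      show "\<exists>x\<in>W. card {y\<in>W. adj x y} < l" if "W \<subseteq> V" "W \<noteq> {}" for W
        using finite_subset[OF that(1) V(1)] that(2) irrefl noadjpath
        by (rule low_degree_vertex_if_no_path)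
      show "card {y\<in>V. \<forall>x\<in>X. adj x y} < q" if X: "X \<subseteq> V" "card X = Suc t" for X
      proof (rule ccontr)
        assume "\<not> ?thesis"
        then have "q \<le> card {y\<in>V. \<forall>x\<in>X. adj x y}" by simp
        from obtain_subset_with_card_n[OF this] 
        obtain B where B: "B \<subseteq> {y\<in>V. \<forall>x\<in>X. adj x y}" "card B = q" "finite B" .
        have "contains_copy F (blowup k (complete_bipartite (t + 1) q))"
        proof (rule blowup_of_kernels[OF Fk])
          show "finite X" using X(1) V(1) by (rule finite_subset)
          show "X \<inter> B = {}" using B(1) by (auto simp: adj_def)
          show "delta_kernel s F {x, y}" if "x \<in> X" "y \<in> B" for x y
            using B(1) that by (auto simp: adj_def)
        qed (use X B s in auto)
        then show False using noblow by blast
      qed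
    qed
    have "card A \<le> t * (card V choose (k - 1)) + (\<Sum>S\<in>nsets V (k - 1). card {x\<in>V. \<forall>y\<in>S. adj x y} - t)"
      using F \<open>4 \<le> k\<close> by (intro card_with_centre_le V(1)) (auto simp: A_def)
    also note excess
    also have "C1 * card V \<le> C1 * card V ^ (k - 2)"
      using V \<open>4 \<le> k\<close> by (intro mult_left_mono self_le_power) (auto simp: Suc_le_eq card_gt_0_iff)
    finally have cardA: "card A \<le> t * (card V choose (k - 1)) + C1 * card V ^ (k - 2)" by simp
    have "card (F - A) \<le> k ^ k * ((2 * s * 2 ^ k + 2) ^ Suc (2 ^ k) * (card V choose (k - 2)))"
    proof (rule card_without_centre_le[OF \<open>4 \<le> k\<close> V(1) _ s(1)])
      show "F - A \<subseteq> nsets V k" using F by blast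
      show "\<not> (\<exists>P\<subseteq>F - A. linear_path k l P)" using nopath by blast
      \<comment> \<open>Kernels of \<open>F - A\<close> are kernels of \<open>F\<close>, so a centre
        with respect to the smaller family would already put \<open>e\<close> into
        \<open>A\<close>.\<close>
      show "\<exists>y\<in>e - {x}. \<not> delta_kernel s (F - A) {x, y}" if "e \<in> F - A" "x \<in> e" for e x
      proof (rule ccontr)
        assume "\<not> ?thesis"
        then have "adj x y" if "y \<in> e - {x}" for y
          using that kernel_mono[of s "F - A" "{x, y}" F] by (auto simp: adj_def)
        then show False using \<open>e \<in> F - A\<close> \<open>x \<in> e\<close> by (auto simp: A_def)
      qed
    qed
    also have "\<dots> \<le> C2 * card V ^ (k - 2)"
      unfolding C2_def mult.assoc
      by (cases "k - 2 \<le> card V") (simp_all add: binomial_le_pow binomial_eq_0)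
    finally have "card (F - A) \<le> C2 * card V ^ (k - 2)" .
    moreover have "card F = card A + card (F - A)"
      using finF card_mono[of F A] by (subst card_Diff_subset) (auto simp: A_def)
    ultimately show ?thesis using cardA by (simp add: algebra_simps)
  qed
  then show ?thesis by blast
qed

theorem theorem6p2:
  fixes k l :: nat
  assumes "k \<ge> 4" and "l \<ge> 1"
  shows "\<exists>N::nat. \<forall>t q::nat. t \<ge> 1 \<longrightarrow> q \<ge> 1 \<longrightarrow>
    (\<exists>C::real. \<forall>n\<ge>N. \<forall>F \<subseteq> nsets {1..n} k.
       real (card F) \<ge> real t * real (n choose (k - 1))
          + C * real n powr (real k - 2 + 2 / (real k - 1)) \<longrightarrow>
       contains_linear_path k l F \<or>
       contains_copy F (blowup k (complete_bipartite (t + 1) q)))"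
proof (rule exI[of _ 1], intro allI impI)
  fix t q :: nat
  from card_le_if_no_path_no_blowup[OF assms(1), of l t q, where ?'a = nat] obtain C where
    C: "\<And>V F. finite V \<Longrightarrow> (V :: nat set) \<noteq> {} \<Longrightarrow> F \<subseteq> nsets V k \<Longrightarrow> \<not> (\<exists>P\<subseteq>F. linear_path k l P) \<Longrightarrow>
    \<not> contains_copy F (blowup k (complete_bipartite (t + 1) q)) \<Longrightarrow>
    card F \<le> t * (card V choose (k - 1)) + C * card V ^ (k - 2)" by blast
  show "\<exists>C::real. \<forall>n\<ge>1. \<forall>F \<subseteq> nsets {1..n} k.
       real (card F) \<ge> real t * real (n choose (k - 1))
          + C * real n powr (real k - 2 + 2 / (real k - 1)) \<longrightarrow>
       contains_linear_path k l F \<or>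
       contains_copy F (blowup k (complete_bipartite (t + 1) q))"
  \<comment> \<open>The added 1 makes the assumed lower bound strictly exceed the upper bound, as
    the power of \<open>n\<close> is positive for \<open>n \<ge> 1\<close>.\<close>
  proof (intro exI[of _ "real C + 1"] allI impI, rule ccontr)
    fix n F
    assume n: "1 \<le> n" and F: "F \<subseteq> nsets {1..n} k"
      and large: "real (card F) \<ge> real t * real (n choose (k - 1))
          + (real C + 1) * real n powr (real k - 2 + 2 / (real k - 1))"
      and none: "\<not> (contains_linear_path k l F \<or>
       contains_copy F (blowup k (complete_bipartite (t + 1) q)))"
    have "card F \<le> t * (card {1..n} choose (k - 1)) + C * card {1..n} ^ (k - 2)"
      using n F none contains_linear_pathI by (intro C) auto
    then have "card F \<le> t * (n choose (k - 1)) + C * n ^ (k - 2)" by simp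
    then have "real (card F) \<le> real (t * (n choose (k - 1)) + C * n ^ (k - 2))"
      by (rule of_nat_mono)
    then have small: "real (card F) \<le> real t * real (n choose (k - 1)) + real C * real n ^ (k - 2)"
      by simp
    have "real n ^ (k - 2) = real n powr (real k - 2)"
      using n assms(1) by (simp add: powr_realpow[symmetric] of_nat_diff)
    also have "\<dots> \<le> real n powr (real k - 2 + 2 / (real k - 1))"
      using n assms(1) by (intro powr_mono) auto
    finally have "real C * real n ^ (k - 2) \<le> real C * real n powr (real k - 2 + 2 / (real k - 1))"
      by (intro mult_left_mono) auto
    moreover have "0 < real n powr (real k - 2 + 2 / (real k - 1))" using n by simp
    ultimately show False using small large unfolding distrib_right by linarith
  qed
qed

end
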